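(* Let $m\ge1$, $n=2m+1$, and let $p_1,\dots,p_t$ be all the distinct prime factors of $n$, with $p_i=2q_i+1$. Let $1\le j\le m$. For every integer $r>0$, $$\mathscr{N}_r^{(m,j)}:=\left(\prod_{i=1}^tp_i^{\left\lfloor\frac{r-1}{q_i}\right\rfloor}\right)\mathscr{F}_r^{(m,j)}\in\mathbb{Z}.$$ For $r\le0$, put $\mathscr{N}_r^{(m,j)}:=\mathscr{F}_r^{(m,j)}$ if $n$ has at least two distinct prime factors, and, if $n=p^\alpha$ is a prime power, put $$\mathscr{N}_r^{(m,j)}:=p^{\vartheta}\mathscr{F}_r^{(m,j)},\qquad \vartheta=-\alpha-\left\lfloor\frac{-2r+1-p^{\alpha-1}}{p^\alpha-p^{\alpha-1}}\right\rfloor .$$ Then for $r=0,-1,-2,\dots$: if $n$ has at least two distinct prime factors, the terms $\mathscr{N}_r^{(m,j)}$ are ($n$ times) the renumbered Fleck numbers, $\mathscr{N}_r^{(m,j)}=n\,\mathfrak{F}(-2r+1,(-r+j)\ (\bmod\ n))$; and if $n=p^\alpha$ is a prime power, they are the renumbered Fleck quotients $$\mathscr{N}_r^{(m,j)}=p^{-\left\lfloor\frac{-2r+1-p^{\alpha-1}}{p^\alpha-p^{\alpha-1}}\right\rfloor}\,\mathfrak{F}(-2r+1,(-r+j)\ (\bmod\ n)).$$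
   Context: Fleck numbers: $\mathfrak{F}(N,a\ (\bmod\ n))=\sum_{k\equiv a\ (\mathrm{mod}\ n)}(-1)^k\binom Nk$. Rational interlacing Fibonacci sequences of dimension $m\ge1$. Let $h_k=\frac1{2k+1}\binom{m+k}{2k}$ and let $R_m$ be the $m\times m$ matrix whose first column is $(-h_1,-h_2,\dots,-h_m)^T$, whose entries $(i,i+1)$, $1\le i\le m-1$, equal $1$, and whose other entries are $0$ (it is invertible). Let $B_{\rm odd}$ be the $m\times m$ matrix with $(i,j)$ entry $(-1)^{i+j-1}\binom{2j-1}{j-i}$ (binomial coefficients with negative lower entry are $0$). For $r\in\mathbb{Z}$ and $1\le j\le m$, $\mathscr{F}_r^{(m,j)}$ is the $(j,1)$ entry of $(2m+1)B_{\rm odd}R_m^{r}$. *)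

theory Defs
  imports
    Jordan_Normal_Form.Matrix
    "HOL-Computational_Algebra.Primes"
    "HOL-Number_Theory.Cong"
begin

definition fleck :: "nat \<Rightarrow> int \<Rightarrow> nat \<Rightarrow> int" where
  "fleck N a n = (\<Sum>k | k \<le> N \<and> [int k = a] (mod int n). (-1) ^ k * int (N choose k))"

text \<open>
  Matrices are given by their entries in rows and columns 1 to \<open>m\<close>; the library type of
  matrices counts from 0. So the entry \<open>(i, j)\<close> of \<open>A\<close> is \<open>A $$ (i - 1, j - 1)\<close>.
\<close>

definition square_mat1 :: "nat \<Rightarrow> (nat \<Rightarrow> nat \<Rightarrow> 'a) \<Rightarrow> 'a mat" where
  "square_mat1 m f = mat m m (\<lambda>(i, j). f (i + 1) (j + 1))"

definition h :: "nat \<Rightarrow> nat \<Rightarrow> rat" where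
  "h m k = of_nat ((m + k) choose (2 * k)) / of_nat (2 * k + 1)"

definition R_mat :: "nat \<Rightarrow> rat mat" where
  "R_mat m = square_mat1 m (\<lambda>i j. if j = 1 then - h m i else if j = i + 1 then 1 else 0)"

text \<open>The case distinction is needed because subtraction of natural numbers truncates at 0.\<close>

definition B_odd :: "nat \<Rightarrow> rat mat" where
  "B_odd m = square_mat1 m (\<lambda>i j.
     if i \<le> j then (-1) ^ (i + j - 1) * of_nat ((2 * j - 1) choose (j - i)) else 0)"

text \<open>
  The power with integer exponent is the one of the matrix ring; for negative exponents it
  uses the inverse in that ring, which exists by the following lemma.
\<close>

lemma R_mat_Units:
  assumes "m \<ge> 1"
  shows "R_mat m \<in> Units (ring_mat TYPE(rat) m ())"
proof -
  obtain c :: rat where hm: "c * h m m = 1"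
  proof
    have "(of_nat (2 * m + 1) :: rat) \<noteq> 0"
      by (metis of_nat_eq_0_iff Suc_eq_plus1 nat.distinct(1))
    moreover have "h m m = 1 / of_nat (2 * m + 1)"
      unfolding h_def mult_2[symmetric] by (simp only: binomial_n_n of_nat_1)
    ultimately show "of_nat (2 * m + 1) * h m m = 1"
      by (simp only: times_divide_eq_right mult_1_right divide_self not_False_eq_True)
  qed
  define V :: "rat mat" where
    "V = square_mat1 m (\<lambda>i j. if j = m then (if i = 1 then - c else - c * h m (i - 1))
                            else if i = j + 1 then 1 else 0)"
  have car: "R_mat m \<in> carrier_mat m m" "V \<in> carrier_mat m m"
    by (auto simp: R_mat_def V_def square_mat1_def)
  have RV: "R_mat m * V = 1\<^sub>m m"
  proof (rule eq_matI)
    fix i j assume "i < dim_row (1\<^sub>m m :: rat mat)" "j < dim_col (1\<^sub>m m :: rat mat)"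
    hence ij: "i < m" "j < m" by auto
    have R: "R_mat m $$ (i, k) = (if k = 0 then - h m (i + 1) else 0) + (if k = i + 1 then 1 else 0)"
      if "k < m" for k
      using ij that by (auto simp: R_mat_def square_mat1_def)
    have "(R_mat m * V) $$ (i, j) = (\<Sum>k<m. R_mat m $$ (i, k) * V $$ (k, j))"
      using ij car by (simp add: scalar_prod_def atLeast0LessThan)
    also have "\<dots> = (\<Sum>k<m. (if k = 0 then - h m (i + 1) * V $$ (k, j) else 0)
                        + (if k = i + 1 then V $$ (k, j) else 0))"
      by (rule sum.cong) (auto simp: R algebra_simps)
    also have "\<dots> = - h m (i + 1) * V $$ (0, j) + (if i + 1 < m then V $$ (i + 1, j) else 0)"
      using assms by (simp add: sum.distrib)
    also have "\<dots> = 1\<^sub>m m $$ (i, j)"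
    proof (cases "i + 1 < m")
      case True
      then show ?thesis
        using ij by (auto simp: V_def square_mat1_def algebra_simps)
    next
      case False
      hence im: "i + 1 = m" using ij by simp
      have "- h m (i + 1) * V $$ (0, j) = (if j + 1 = m then c * h m m else 0)"
        using ij im by (simp add: V_def square_mat1_def algebra_simps)
      then show ?thesis
        using False ij im hm by auto
    qed
    finally show "(R_mat m * V) $$ (i, j) = 1\<^sub>m m $$ (i, j)" .
  qed (use car in auto)
  have VR: "V * R_mat m = 1\<^sub>m m"
  proof (rule eq_matI)
    fix i j assume "i < dim_row (1\<^sub>m m :: rat mat)" "j < dim_col (1\<^sub>m m :: rat mat)"
    hence ij: "i < m" "j < m" by auto
    define v where "v = (if i = 0 then - c else - c * h m i)"
    have V: "V $$ (i, k) = (if k = m - 1 then v else 0)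
        + (if 0 < i \<and> k = i - 1 then 1 else 0)"
      if "k < m" for k
      using ij that by (auto simp: V_def v_def square_mat1_def)
    have "(V * R_mat m) $$ (i, j) = (\<Sum>k<m. V $$ (i, k) * R_mat m $$ (k, j))"
      using ij car by (simp add: scalar_prod_def atLeast0LessThan)
    also have "\<dots> = (\<Sum>k<m. (if k = m - 1 then v * R_mat m $$ (k, j) else 0)
        + (if k = i - 1 then (if 0 < i then R_mat m $$ (k, j) else 0) else 0))"
      by (rule sum.cong) (auto simp: V algebra_simps)
    also have "\<dots> = v * R_mat m $$ (m - 1, j) + (if 0 < i then R_mat m $$ (i - 1, j) else 0)"
      using assms ij by (simp add: sum.distrib)
    also have "\<dots> = 1\<^sub>m m $$ (i, j)"
    proof (cases "j = 0")
      case True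
      have "R_mat m $$ (m - 1, j) = - h m m"
        using True assms by (simp add: R_mat_def square_mat1_def)
      moreover have "R_mat m $$ (i - 1, j) = - h m i" if "0 < i"
        using True ij that by (simp add: R_mat_def square_mat1_def)
      ultimately show ?thesis
        using True ij hm by (auto simp: v_def)
    next
      case False
      then show ?thesis
        using ij by (auto simp: R_mat_def square_mat1_def)
    qed
    finally show "(V * R_mat m) $$ (i, j) = 1\<^sub>m m $$ (i, j)" .
  qed (use car in auto)
  show ?thesis
    using car RV VR by (auto simp: Units_def ring_mat_simps)
qed

definition fib_seq :: "nat \<Rightarrow> nat \<Rightarrow> int \<Rightarrow> rat" where
  "fib_seq m j r =
     (of_nat (2 * m + 1) \<cdot>\<^sub>m (B_odd m * (R_mat m [^]\<^bsub>ring_mat TYPE(rat) m ()\<^esub> r))) $$ (j - 1, 0)"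

text \<open>
  Here \<open>div\<close> on integers is the floor of the quotient, also for a negative dividend. Since
  \<open>2 * m + 1\<close> is odd, \<open>(p - 1) div 2\<close> below is exact. The last case is only reached
  when \<open>2 * m + 1\<close> is a prime power (for \<open>m \<ge> 1\<close>), and then \<open>p\<close> is its prime.
\<close>

definition N_seq :: "nat \<Rightarrow> nat \<Rightarrow> int \<Rightarrow> rat" where
  "N_seq m j r =
     (if r > 0 then
        (\<Prod>p\<in>prime_factors (2 * m + 1). of_nat p powi ((r - 1) div int ((p - 1) div 2)))
          * fib_seq m j r
      else if card (prime_factors (2 * m + 1)) \<ge> 2 then fib_seq m j r
      else
        (let p = (THE p. p \<in> prime_factors (2 * m + 1));
             \<alpha> = multiplicity p (2 * m + 1);
             \<theta> = - int \<alpha> - (- 2 * r + 1 - int p ^ (\<alpha> - 1)) div (int p ^ \<alpha> - int p ^ (\<alpha> - 1))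
         in of_nat p powi \<theta> * fib_seq m j r))"

end

theory Submission
  imports Defs
begin

text \<open>
  Write \<open>F\<close> for the sequence \<open>fib_seq m j\<close>, \<open>n = 2 * m + 1\<close> and \<open>h\<^sub>k = h m k\<close>. The matrix \<open>R_mat m\<close>
  shifts columns, so the first column of its powers satisfies the linear recurrence
  \<open>F r = - (\<Sum>k = 1..m. h\<^sub>k * F (r - k))\<close> for all integers \<open>r\<close>, and the \<open>m\<close> initial values
  \<open>F 0, F (- 1), \<dots>, F (1 - m)\<close> are \<open>n\<close> times the row \<open>j\<close> of \<open>B_odd m\<close>. The whole theorem follows from
  this.

  For \<open>r \<le> 0\<close> it remains to see that the numbers \<open>G s j = fleck (2 * s + 1) (s + j) n\<close> satisfy the
  same recurrence with the same initial values. Here \<open>G s j\<close> is the coefficient of \<open>x ^ j\<close> in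
  \<open>(1 - x) * \<mu> ^ s\<close> modulo \<open>x ^ n - 1\<close>, where \<open>\<mu> = x - 2 + 1 / x\<close>. Passing from \<open>s\<close> to \<open>s + 1\<close> is
  therefore taking a second difference in \<open>j\<close> (\<open>fleck_second_difference\<close>). The numbers
  \<open>n * h\<^sub>k\<close> are the coefficients of the polynomial in \<open>\<mu>\<close> that equals the Laurent polynomial
  \<open>\<Sum>i = - m..m. x ^ i\<close> (\<open>sum_dirichlet_coeff_second_difference\<close>; with \<open>x = exp (2 * \<i> * t)\<close> this is
  \<open>sin (n * t) / sin t\<close> as a polynomial in \<open>- 4 * (sin t)\<^sup>2\<close>). Hence
  \<open>\<Sum>k \<le> m. n * h\<^sub>k * G (s + k) j\<close> is the sum of \<open>G s\<close> over a full period of length \<open>n\<close>, which is an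
  alternating sum of a whole row of binomial coefficients and vanishes (\<open>fleck_period_sum\<close>).

  For \<open>r > 0\<close> the denominators are bounded by induction along the recurrence. Since \<open>n * h\<^sub>k\<close> and
  \<open>(2 * k + 1) * h\<^sub>k\<close> are integers, only primes \<open>p = 2 * q + 1\<close> dividing \<open>n\<close> occur in the denominator of
  \<open>h\<^sub>k\<close>, with an exponent \<open>v\<close> such that \<open>p ^ v \<le> 2 * k + 1\<close>; Bernoulli's inequality gives \<open>q * v \<le> k\<close>
  (\<open>denominator_bound_mult_h\<close>). Superadditivity of \<open>k \<mapsto> \<lfloor>k / q\<rfloor>\<close> then carries the bound through the terms of
  the recurrence with positive index, and the other terms are integers because there \<open>F\<close> is divisible
  by \<open>n\<close>.
\<close>

section \<open>Powers of the matrix and the linear recurrence\<close>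

lemma (in monoid) Units_int_pow_step:
  assumes "x \<in> Units G"
  shows "x [^] (r::int) = x [^] (r - 1) \<otimes> x"
proof (cases "r > 0")
  case True
  then obtain k where "r = int (Suc k)"
    by (metis gr0_implies_Suc pos_int_cases)
  then show ?thesis
    by (simp add: int_pow_int del: of_nat_Suc) (simp add: int_pow_int)
next
  case False
  define s where "s = nat (- r)"
  have r: "r = - int s"
    using False by (simp add: s_def)
  have U: "x [^] s \<in> Units G"
    using assms by (induction s) auto
  have x: "x \<in> carrier G"
    using assms by (rule Units_closed)
  have pred: "x [^] (r - 1) = inv (x [^] Suc s)"
    using r by (simp add: int_pow_def2 nat_add_distrib del: nat_pow_Suc)
  have U': "x [^] Suc s \<in> Units G"
    using assms U by simp
  have "(inv (x [^] Suc s) \<otimes> x) \<otimes> x [^] s = inv (x [^] Suc s) \<otimes> x [^] Suc s"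
    unfolding nat_pow_Suc2[OF x] using x U U' nat_pow_Suc2[OF x, of s] by (simp add: m_assoc)
  also have "\<dots> = \<one>"
    using U' by (rule Units_l_inv)
  finally have "inv (x [^] Suc s) \<otimes> x = inv (x [^] s)"
    using x U U' by (intro inv_unique[OF _ Units_r_inv[OF U]]) auto
  then have "x [^] (r - 1) \<otimes> x = inv (x [^] s)"
    by (simp only: pred)
  also have "\<dots> = x [^] r"
    using r by (simp add: int_pow_def2)
  finally show ?thesis ..
qed

lemma (in monoid) Units_int_pow_closed:
  assumes "x \<in> Units G"
  shows "x [^] (r::int) \<in> carrier G"
proof -
  have U: "x [^] (k::nat) \<in> Units G" for k
    using assms by (induction k) auto
  show ?thesis
    unfolding int_pow_def2[of G x r] using U[THEN Units_closed] U[THEN Units_inv_closed] by presburger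
qed

abbreviation R_pow :: "nat \<Rightarrow> int \<Rightarrow> rat mat" where
  "R_pow m r \<equiv> R_mat m [^]\<^bsub>ring_mat TYPE(rat) m ()\<^esub> r"

lemma R_pow_carrier:
  assumes "m \<ge> 1"
  shows "R_pow m r \<in> carrier_mat m m"
proof -
  interpret ring "ring_mat TYPE(rat) m ()"
    by (rule ring_mat)
  show ?thesis
    using Units_int_pow_closed[OF R_mat_Units[OF assms]] by (simp add: ring_mat_simps)
qed

lemma R_pow_step_index:
  assumes "m \<ge> 1" "i < m" "l < m"
  shows "R_pow m r $$ (i, l) = (\<Sum>t<m. R_pow m (r - 1) $$ (i, t) * R_mat m $$ (t, l))"
proof -
  interpret ring "ring_mat TYPE(rat) m ()"
    by (rule ring_mat)
  have "R_pow m r = R_pow m (r - 1) * R_mat m"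
    using Units_int_pow_step[OF R_mat_Units[OF assms(1)], of r] by (simp add: ring_mat_simps)
  moreover have "R_mat m \<in> carrier_mat m m"
    by (simp add: R_mat_def square_mat1_def)
  ultimately show ?thesis
    using assms R_pow_carrier[OF assms(1), of "r - 1"]
    by (simp add: scalar_prod_def atLeast0LessThan)
qed

lemma R_pow_Suc_column:
  assumes "m \<ge> 1" "i < m" "Suc l < m"
  shows "R_pow m r $$ (i, Suc l) = R_pow m (r - 1) $$ (i, l)"
proof -
  have "R_pow m r $$ (i, Suc l) = (\<Sum>t<m. if t = l then R_pow m (r - 1) $$ (i, t) else 0)"
    unfolding R_pow_step_index[OF assms]
    by (rule sum.cong) (use assms in \<open>auto simp: R_mat_def square_mat1_def\<close>)
  then show ?thesis
    using assms by simp
qed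

text \<open>
  This is why a single scalar sequence carries all powers: column \<open>l\<close> of a power is the first column
  of the power \<open>l\<close> steps earlier.
\<close>

lemma R_pow_column:
  assumes "m \<ge> 1" "i < m" "l < m"
  shows "R_pow m r $$ (i, l) = R_pow m (r - int l) $$ (i, 0)"
  using assms(3)
proof (induction l arbitrary: r)
  case (Suc l)
  then show ?case
    using R_pow_Suc_column[of m i l r] Suc.IH[of "r - 1"] assms by (simp add: algebra_simps)
qed simp

lemma R_pow_first_column_recurrence:
  assumes "m \<ge> 1" "i < m"
  shows "R_pow m r $$ (i, 0) = - (\<Sum>k=1..m. h m k * R_pow m (r - int k) $$ (i, 0))"
proof -
  have m: "0 < m"
    using assms(1) by simp
  have "R_pow m r $$ (i, 0) = (\<Sum>t<m. - (h m (Suc t) * R_pow m (r - int (Suc t)) $$ (i, 0)))"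
    unfolding R_pow_step_index[OF assms m, of r]
  proof (rule sum.cong)
    fix t assume "t \<in> {..<m}"
    then show "R_pow m (r - 1) $$ (i, t) * R_mat m $$ (t, 0)
        = - (h m (Suc t) * R_pow m (r - int (Suc t)) $$ (i, 0))"
      using R_pow_column[OF assms, of t "r - 1"] assms
      by (simp add: R_mat_def square_mat1_def algebra_simps)
  qed simp
  also have "\<dots> = - (\<Sum>k=1..m. h m k * R_pow m (r - int k) $$ (i, 0))"
    by (simp add: sum_negf sum.atLeast1_atMost_eq)
  finally show ?thesis .
qed

lemma fib_seq_eq_sum:
  assumes "m \<ge> 1" "1 \<le> j" "j \<le> m"
  shows "fib_seq m j r
    = of_nat (2 * m + 1) * (\<Sum>i<m. B_odd m $$ (j - 1, i) * R_pow m r $$ (i, 0))"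
proof -
  have "B_odd m \<in> carrier_mat m m"
    by (simp add: B_odd_def square_mat1_def)
  then show ?thesis
    using assms R_pow_carrier[OF assms(1), of r]
    by (simp add: fib_seq_def scalar_prod_def atLeast0LessThan)
qed

lemma fib_seq_recurrence:
  assumes "m \<ge> 1" "1 \<le> j" "j \<le> m"
  shows "fib_seq m j r = - (\<Sum>k=1..m. h m k * fib_seq m j (r - int k))"
proof -
  have "(\<Sum>i<m. B_odd m $$ (j - 1, i) * R_pow m r $$ (i, 0))
    = (\<Sum>i<m. - (\<Sum>k=1..m. h m k * (B_odd m $$ (j - 1, i) * R_pow m (r - int k) $$ (i, 0))))"
    by (rule sum.cong)
       (use R_pow_first_column_recurrence[OF assms(1), of _ r] in
         \<open>auto simp: sum_distrib_left algebra_simps\<close>)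
  also have "\<dots> = - (\<Sum>k=1..m. h m k * (\<Sum>i<m. B_odd m $$ (j - 1, i) * R_pow m (r - int k) $$ (i, 0)))"
    unfolding sum_negf sum_distrib_left by (subst sum.swap) simp
  finally show ?thesis
    by (simp add: fib_seq_eq_sum[OF assms] sum_distrib_left mult.left_commute)
qed

lemma fib_seq_initial:
  assumes "m \<ge> 1" "1 \<le> j" "j \<le> m" "l < m"
  shows "fib_seq m j (- int l) = of_nat (2 * m + 1) * B_odd m $$ (j - 1, l)"
proof -
  have "R_pow m (- int l) $$ (i, 0) = (if i = l then 1 else 0)" if "i < m" for i
    using R_pow_column[OF assms(1) that assms(4), of 0] that assms(4)
    by (simp add: ring_mat_simps)
  then have "(\<Sum>i<m. B_odd m $$ (j - 1, i) * R_pow m (- int l) $$ (i, 0))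
      = (\<Sum>i<m. if i = l then B_odd m $$ (j - 1, i) else 0)"
    by (intro sum.cong) auto
  then show ?thesis
    using assms by (simp add: fib_seq_eq_sum)
qed

section \<open>The coefficients as a window sum operator\<close>

text \<open>
  The coefficient of \<open>\<mu> ^ k\<close> in the polynomial in \<open>\<mu> = x - 2 + 1 / x\<close> that equals \<open>\<Sum>i = - m..m. x ^ i\<close>.
\<close>

definition dirichlet_coeff :: "nat \<Rightarrow> nat \<Rightarrow> nat" where
  "dirichlet_coeff m k = 2 * ((m + k) choose (2 * k + 1)) + ((m + k) choose (2 * k))"

lemma dirichlet_coeff_eq_h: "of_nat (dirichlet_coeff m k) = of_nat (2 * m + 1) * h m k"
proof (cases "k \<le> m")
  case True
  have "(2 * k + 1) * ((m + k) choose (2 * k + 1)) = (m - k) * ((m + k) choose (2 * k))"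
  proof (cases "k = m")
    case False
    have "Suc (2 * k) * ((m + k) choose Suc (2 * k)) = (m + k) * ((m + k - 1) choose (2 * k))"
      by (metis diff_Suc_1 times_binomial_minus1_eq zero_less_Suc)
    also have "\<dots> = ((m + k) - 2 * k) * ((m + k) choose (2 * k))"
      by (rule binomial_absorb_comp[symmetric])
    finally show ?thesis
      using True by (simp add: mult_2)
  qed simp
  then have "(2 * k + 1) * dirichlet_coeff m k
      = (2 * (m - k) + (2 * k + 1)) * ((m + k) choose (2 * k))"
    unfolding dirichlet_coeff_def by (simp add: algebra_simps)
  also have "2 * (m - k) + (2 * k + 1) = 2 * m + 1"
    using True by simp
  finally have "of_nat (2 * k + 1) * (of_nat (dirichlet_coeff m k) :: rat)
      = of_nat (2 * m + 1) * of_nat ((m + k) choose (2 * k))"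
    by (metis of_nat_mult)
  moreover have "(of_nat (2 * k + 1) :: rat) \<noteq> 0"
    by (metis of_nat_eq_0_iff Suc_eq_plus1 nat.distinct(1))
  ultimately show ?thesis
    unfolding h_def times_divide_eq_right by (metis nonzero_eq_divide_eq mult.commute)
qed (simp add: dirichlet_coeff_def h_def binomial_eq_0)

lemma h_0: "h m 0 = 1"
  by (simp add: h_def)

lemma h_diagonal: "h m m = 1 / of_nat (2 * m + 1)"
  unfolding h_def mult_2[symmetric] by (simp only: binomial_n_n of_nat_1)

text \<open>
  The Chebyshev recurrence \<open>D\<^sub>m\<^sub>+\<^sub>2 + D\<^sub>m = (\<mu> + 2) * D\<^sub>m\<^sub>+\<^sub>1\<close> of the Dirichlet kernels, read off the
  coefficients.
\<close>

lemma dirichlet_coeff_recurrence_0: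
  "dirichlet_coeff (Suc (Suc m)) 0 + dirichlet_coeff m 0 = 2 * dirichlet_coeff (Suc m) 0"
  by (simp add: dirichlet_coeff_def)

lemma dirichlet_coeff_recurrence_Suc:
  "dirichlet_coeff (Suc (Suc m)) (Suc k) + dirichlet_coeff m (Suc k)
    = 2 * dirichlet_coeff (Suc m) (Suc k) + dirichlet_coeff (Suc m) k"
  by (simp add: dirichlet_coeff_def)

lemma sum_int_window_Suc:
  fixes f :: "int \<Rightarrow> 'a::comm_monoid_add"
  shows "(\<Sum>i=- int (Suc m)..int (Suc m). f i)
    = f (- int (Suc m)) + (\<Sum>i=- int m..int m. f i) + f (int (Suc m))"
proof -
  have "{- int (Suc m)..int (Suc m)}
      = insert (- int (Suc m)) (insert (int (Suc m)) {- int m..int m})"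
    by auto
  then show ?thesis
    by (simp add: ac_simps)
qed

text \<open>
  If \<open>g s\<close> is the \<open>s\<close>-th iterated second difference of \<open>g 0\<close>, then \<open>\<mu>\<close> acts by \<open>g s \<mapsto> g (s + 1)\<close> and
  \<open>x\<close> by a translation, and this is the identity between the polynomial in \<open>\<mu>\<close> and the Laurent polynomial
  \<open>\<Sum>i = - m..m. x ^ i\<close>. Both sides satisfy the three-term recurrence in \<open>m\<close>. The upper summation
  bound is arbitrary so that the different terms of this recurrence share one index range.
\<close>

lemma sum_dirichlet_coeff_second_difference:
  fixes g :: "nat \<Rightarrow> int \<Rightarrow> 'a::comm_ring_1"
  assumes step: "\<And>s a. g (Suc s) a = g s (a + 1) - 2 * g s a + g s (a - 1)"
    and "m \<le> K"
  shows "(\<Sum>k\<le>K. of_nat (dirichlet_coeff m k) * g (s + k) a) = (\<Sum>i=- int m..int m. g s (a + i))"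
  using assms(2)
proof (induction m arbitrary: K s a rule: induct_nat_012)
  case 0
  have "(\<Sum>k\<le>K. of_nat (dirichlet_coeff 0 k) * g (s + k) a) = (\<Sum>k\<le>K. if k = 0 then g (s + k) a else 0)"
    by (rule sum.cong) (auto simp: dirichlet_coeff_def binomial_eq_0)
  then show ?case
    by simp
next
  case 1
  have "(\<Sum>k\<le>K. of_nat (dirichlet_coeff (Suc 0) k) * g (s + k) a)
      = (\<Sum>k\<le>K. (if k = 0 then 3 * g (s + k) a else 0) + (if k = 1 then g (s + k) a else 0))"
    by (rule sum.cong) (auto simp: dirichlet_coeff_def binomial_eq_0 numeral_2_eq_2)
  also have "\<dots> = 3 * g s a + g (Suc s) a"
    using 1 by (simp add: sum.distrib)
  also have "\<dots> = g s (a - 1) + g s a + g s (a + 1)"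
    by (simp add: step algebra_simps)
  finally show ?case
    using sum_int_window_Suc[of "\<lambda>i. g s (a + i)" 0] by simp
next
  case (ge2 m)
  obtain L where K: "K = Suc L"
    using ge2.prems by (cases K) auto
  define W where "W l s a = (\<Sum>i=- int l..int l. g s (a + i))" for l s a
  let ?S = "\<lambda>l K s. (\<Sum>k\<le>K. of_nat (dirichlet_coeff l k) * g (s + k) a)"
  have "?S (Suc (Suc m)) K s + ?S m K s
      = (\<Sum>k\<le>K. of_nat (dirichlet_coeff (Suc (Suc m)) k + dirichlet_coeff m k) * g (s + k) a)"
    by (simp add: sum.distrib[symmetric] algebra_simps)
  also have "\<dots> = 2 * ?S (Suc m) K s + ?S (Suc m) L (Suc s)"
    unfolding K sum.atMost_Suc_shift dirichlet_coeff_recurrence_0 dirichlet_coeff_recurrence_Suc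
    by (simp add: sum.distrib sum_distrib_left algebra_simps)
  also have "?S (Suc m) K s = W (Suc m) s a"
    unfolding W_def using ge2.prems by (intro ge2.IH) simp
  also have "?S (Suc m) L (Suc s) = W (Suc m) (Suc s) a"
    unfolding W_def using ge2.prems K by (intro ge2.IH) simp
  also have "?S m K s = W m s a"
    unfolding W_def using ge2.prems by (intro ge2.IH) simp
  finally have *: "?S (Suc (Suc m)) K s = 2 * W (Suc m) s a + W (Suc m) (Suc s) a - W m s a"
    by (simp add: algebra_simps)
  have "W (Suc m) (Suc s) a = W (Suc m) s (a + 1) - 2 * W (Suc m) s a + W (Suc m) s (a - 1)"
    by (simp add: W_def step sum.distrib sum_subtractf sum_distrib_left algebra_simps)
  moreover have "W (Suc m) s (a + 1) + W (Suc m) s (a - 1) = W (Suc (Suc m)) s a + W m s a"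
  proof -
    have shift: "W (Suc m) s (a + d) = (\<Sum>i=- int (Suc m) + d..int (Suc m) + d. g s (a + i))" for d
      unfolding W_def
      by (rule sum.reindex_bij_witness[of _ "\<lambda>i. i - d" "\<lambda>i. i + d"]) (auto simp: algebra_simps)
    have R: "{- int (Suc m) + 1..int (Suc m) + 1}
        = insert (int m + 1) (insert (int m + 2) {- int m..int m})"
      and L: "{- int (Suc m) + - 1..int (Suc m) + - 1}
        = insert (- int m - 1) (insert (- int m - 2) {- int m..int m})"
      by auto
    have "W (Suc m) s (a + 1) = g s (a + (int m + 1)) + g s (a + (int m + 2)) + W m s a"
      unfolding shift R by (simp add: W_def algebra_simps)
    moreover have "W (Suc m) s (a + - 1) = g s (a + (- int m - 1)) + g s (a + (- int m - 2)) + W m s a"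
      unfolding shift L by (simp add: W_def algebra_simps)
    moreover have "W (Suc (Suc m)) s a = g s (a + (- int m - 2)) + (g s (a + (- int m - 1)) + W m s a
        + g s (a + (int m + 1))) + g s (a + (int m + 2))"
      unfolding W_def sum_int_window_Suc by (simp add: algebra_simps)
    ultimately show ?thesis
      by (simp add: algebra_simps)
  qed
  ultimately show ?case
    unfolding * W_def[symmetric] by (simp add: algebra_simps)
qed

section \<open>Fleck numbers\<close>

lemma fleck_eq_sum_if:
  "fleck N a n = (\<Sum>k\<le>N. if [int k = a] (mod int n) then (-1) ^ k * int (N choose k) else 0)"
  unfolding fleck_def by (rule sum.mono_neutral_cong_left) auto

lemma fleck_Suc: "fleck (Suc N) a n = fleck N a n - fleck N (a - 1) n"
proof -
  define u where "u a k = (if [int k = a] (mod int n) then (-1) ^ k else (0::int))" for a k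
  have fleck: "fleck N a n = (\<Sum>k\<le>N. u a k * int (N choose k))" for N a
    unfolding fleck_eq_sum_if by (rule sum.cong) (auto simp: u_def)
  have "[int (Suc k) = a] (mod int n) \<longleftrightarrow> [int k = a - 1] (mod int n)" for k
    using cong_add_rcancel[of "int k" 1 "a - 1" "int n"] by (simp add: add.commute)
  then have u_Suc: "u a (Suc k) = - u (a - 1) k" for k
    by (simp add: u_def)
  have "fleck (Suc N) a n = u a 0 + (\<Sum>k\<le>N. u a (Suc k) * int (N choose Suc k))
      + (\<Sum>k\<le>N. u a (Suc k) * int (N choose k))"
    unfolding fleck sum.atMost_Suc_shift by (simp add: sum.distrib algebra_simps)
  also have "u a 0 + (\<Sum>k\<le>N. u a (Suc k) * int (N choose Suc k)) = (\<Sum>k\<le>Suc N. u a k * int (N choose k))"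
    unfolding sum.atMost_Suc_shift by simp
  also have "\<dots> = fleck N a n"
    unfolding fleck by simp
  also have "(\<Sum>k\<le>N. u a (Suc k) * int (N choose k)) = - fleck N (a - 1) n"
    unfolding fleck u_Suc by (simp add: sum_negf)
  finally show ?thesis
    by simp
qed

lemma fleck_second_difference:
  "fleck (2 * Suc s + 1) (int (Suc s) + a) n
    = fleck (2 * s + 1) (int s + (a + 1)) n - 2 * fleck (2 * s + 1) (int s + a) n
      + fleck (2 * s + 1) (int s + (a - 1)) n"
  using fleck_Suc[of "Suc (2 * s + 1)" "int s + 1 + a" n] fleck_Suc[of "2 * s + 1" "int s + 1 + a" n]
    fleck_Suc[of "2 * s + 1" "int s + a" n]
  by (simp add: algebra_simps)

lemma fleck_period_sum:
  assumes "N > 0"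
  shows "(\<Sum>i=- int m..int m. fleck N (a + i) (2 * m + 1)) = 0"
proof -
  let ?n = "int (2 * m + 1)"
  have one: "(\<Sum>i=- int m..int m. if [int k = a + i] (mod ?n) then c else 0) = c" for k and c :: int
  proof -
    define w where "w = (int k - a + int m) mod ?n"
    define i0 where "i0 = w - int m"
    have range: "0 \<le> w" "w < ?n"
      by (simp_all add: w_def)
    have "[int k = a + i] (mod ?n) \<longleftrightarrow> i = i0" if "i \<in> {- int m..int m}" for i
    proof -
      have "[int k = a + i] (mod ?n) \<longleftrightarrow> [int k - a + int m = i + int m] (mod ?n)"
        using cong_add_rcancel[of "int k" "int m - a" "a + i" ?n] by (simp add: algebra_simps)
      also have "\<dots> \<longleftrightarrow> (int k - a + int m) mod ?n = i + int m"
        using that by (simp add: cong_def)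
      finally show ?thesis
        by (auto simp: i0_def w_def)
    qed
    then have "(\<Sum>i=- int m..int m. if [int k = a + i] (mod ?n) then c else 0)
        = (\<Sum>i=- int m..int m. if i = i0 then c else 0)"
      by (intro sum.cong) auto
    also have "i0 \<in> {- int m..int m}"
      using range by (auto simp: i0_def)
    then have "(\<Sum>i=- int m..int m. if i = i0 then c else 0) = c"
      by simp
    finally show ?thesis .
  qed
  have "(\<Sum>i=- int m..int m. fleck N (a + i) (2 * m + 1)) = (\<Sum>k\<le>N. (-1) ^ k * int (N choose k))"
    unfolding fleck_eq_sum_if by (subst sum.swap) (simp only: one)
  then show ?thesis
    using choose_alternating_sum[OF assms, where 'a = int] by simp
qed

lemma fleck_recurrence:
  "(\<Sum>k\<le>m. h m k * of_int (fleck (2 * (s + k) + 1) (int (s + k) + a) (2 * m + 1))) = 0"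
proof -
  let ?G = "\<lambda>s a. fleck (2 * s + 1) (int s + a) (2 * m + 1)"
  have "(\<Sum>k\<le>m. of_nat (dirichlet_coeff m k) * ?G (s + k) a) = (\<Sum>i=- int m..int m. ?G s (a + i))"
    by (rule sum_dirichlet_coeff_second_difference[of ?G]) (use fleck_second_difference in auto)
  also have "\<dots> = 0"
    using fleck_period_sum[of "2 * s + 1" "int s + a" m] by (simp add: add.assoc)
  finally have "of_int (\<Sum>k\<le>m. of_nat (dirichlet_coeff m k) * ?G (s + k) a) = (0::rat)"
    by (simp only: of_int_0)
  then have "of_nat (2 * m + 1) * (\<Sum>k\<le>m. h m k * of_int (?G (s + k) a)) = (0::rat)"
    by (simp only: of_int_sum of_int_mult of_int_of_nat_eq dirichlet_coeff_eq_h sum_distrib_left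
        mult.assoc)
  moreover have "(of_nat (2 * m + 1) :: rat) \<noteq> 0"
    by (metis of_nat_eq_0_iff Suc_eq_plus1 nat.distinct(1))
  ultimately show ?thesis
    unfolding mult_eq_0_iff by blast
qed

text \<open>
  Here \<open>2 * l + 1\<close> and \<open>l + j\<close> are both less than the modulus, so a single index contributes.
\<close>

lemma fleck_eq_B_odd:
  assumes "1 \<le> j" "j \<le> m" "l < m"
  shows "of_int (fleck (2 * l + 1) (int l + int j) (2 * m + 1)) = B_odd m $$ (j - 1, l)"
proof -
  have "[int k = int l + int j] (mod int (2 * m + 1)) \<longleftrightarrow> k = l + j" if "k \<le> 2 * l + 1" for k
  proof -
    have "[int k = int l + int j] (mod int (2 * m + 1)) \<longleftrightarrow> [k = l + j] (mod (2 * m + 1))"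
      by (simp only: of_nat_add[symmetric] cong_int_iff)
    also have "\<dots> \<longleftrightarrow> k = l + j"
      using that assms by (simp add: cong_def)
    finally show ?thesis .
  qed
  then have "fleck (2 * l + 1) (int l + int j) (2 * m + 1)
      = (\<Sum>k\<le>2 * l + 1. if k = l + j then (-1) ^ k * int ((2 * l + 1) choose k) else 0)"
    unfolding fleck_eq_sum_if by (intro sum.cong) auto
  also have "\<dots> = (if j \<le> l + 1 then (-1) ^ (l + j) * int ((2 * l + 1) choose (l + j)) else 0)"
  proof -
    have "l + j \<le> 2 * l + 1 \<longleftrightarrow> j \<le> l + 1"
      by auto
    then show ?thesis
      by (simp only: sum.delta finite_atMost atMost_iff)
  qed
  also have "\<dots> = (if j \<le> l + 1 then (-1) ^ (l + j) * int ((2 * l + 1) choose (l + 1 - j)) else 0)"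
  proof (cases "j \<le> l + 1")
    case True
    then have "((2 * l + 1) choose (l + j)) = ((2 * l + 1) choose (l + 1 - j))"
      using binomial_symmetric[of "l + j" "2 * l + 1"] by simp
    then show ?thesis
      by (simp only:)
  qed simp
  finally show ?thesis
    using assms by (auto simp: B_odd_def square_mat1_def add.commute)
qed

text \<open>
  Running the recurrence backwards determines \<open>fib_seq\<close> at \<open>- s\<close> from its values at the \<open>m\<close> next larger
  indices, because the last coefficient \<open>h m m\<close> does not vanish.
\<close>

lemma fib_seq_nonpos:
  assumes "m \<ge> 1" "1 \<le> j" "j \<le> m"
  shows "fib_seq m j (- int s)
    = of_nat (2 * m + 1) * of_int (fleck (2 * s + 1) (int s + int j) (2 * m + 1))"
proof (induction s rule: less_induct)
  case (less s)
  show ?case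
  proof (cases "s < m")
    case True
    then show ?thesis
      using fib_seq_initial[OF assms True] fleck_eq_B_odd[OF assms(2,3) True] by simp
  next
    case False
    define t where "t = s - m"
    have s: "s = t + m"
      using False by (simp add: t_def)
    let ?A = "\<lambda>k. fib_seq m j (- int (t + k))"
    let ?G = "\<lambda>k. of_nat (2 * m + 1) * of_int (fleck (2 * (t + k) + 1) (int (t + k) + int j) (2 * m + 1)) :: rat"
    have split: "(\<Sum>k\<le>m. f k) = (\<Sum>k<m. f k) + f m" for f :: "nat \<Rightarrow> rat"
      by (simp add: lessThan_Suc_atMost[symmetric])
    have "(\<Sum>k\<le>m. h m k * ?A k) = h m 0 * ?A 0 + (\<Sum>k=1..m. h m k * ?A k)"
      by (simp add: atMost_atLeast0 sum.atLeast_Suc_atMost)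
    also have "\<dots> = 0"
    proof -
      have "- int (t + k) = - int t - int k" for k
        by simp
      then show ?thesis
        using fib_seq_recurrence[OF assms, of "- int t"] by (simp only: h_0) simp
    qed
    finally have "(\<Sum>k<m. h m k * ?A k) + h m m * ?A m = 0"
      by (simp only: split)
    moreover have "(\<Sum>k<m. h m k * ?A k) = (\<Sum>k<m. h m k * ?G k)"
    proof (rule sum.cong)
      fix k assume "k \<in> {..<m}"
      then have "?A k = ?G k"
        using s by (intro less.IH) simp
      then show "h m k * ?A k = h m k * ?G k"
        by (simp only:)
    qed simp
    moreover have "(\<Sum>k<m. h m k * ?G k) + h m m * ?G m = 0"
    proof -
      have "(\<Sum>k\<le>m. h m k * ?G k)
          = of_nat (2 * m + 1) * (\<Sum>k\<le>m. h m k * of_int (fleck (2 * (t + k) + 1) (int (t + k) + int j) (2 * m + 1)))"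
        unfolding sum_distrib_left by (simp only: mult.left_commute)
      also have "\<dots> = 0"
        by (simp only: fleck_recurrence mult_zero_right)
      finally show ?thesis
        by (simp only: split)
    qed
    ultimately have "h m m * ?A m = h m m * ?G m"
      by linarith
    moreover have "h m m \<noteq> 0"
      unfolding h_diagonal of_nat_Suc[symmetric] Suc_eq_plus1[symmetric]
      by (simp del: of_nat_Suc)
    ultimately show ?thesis
      unfolding s mult_cancel_left by blast
  qed
qed

section \<open>Denominators at positive indices\<close>

definition denominator_bound :: "nat \<Rightarrow> nat \<Rightarrow> nat" where
  "denominator_bound n k = (\<Prod>p\<in>prime_factors n. p ^ (k div ((p - 1) div 2)))"

lemma denominator_bound_mult_dvd:
  "denominator_bound n a * denominator_bound n b dvd denominator_bound n (a + b)"
proof -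
  have "a div q + b div q \<le> (a + b) div q" for q :: nat
    using div_add1_eq[of a b q] by simp
  then show ?thesis
    unfolding denominator_bound_def prod.distrib[symmetric] power_add[symmetric]
    by (intro prod_dvd_prod le_imp_power_dvd)
qed

text \<open>
  A prime power \<open>p ^ v\<close> dividing \<open>2 * k + 1\<close> is at most \<open>2 * k + 1\<close>, while \<open>p ^ v \<ge> 1 + 2 * q * v\<close> for
  \<open>p = 2 * q + 1\<close>. This is where the exponents \<open>\<lfloor>k / q\<rfloor>\<close> come from.
\<close>

lemma gcd_dvd_denominator_bound:
  assumes "odd n"
  shows "gcd n (2 * k + 1) dvd denominator_bound n k"
proof (rule multiplicity_le_imp_dvd)
  fix p :: nat assume p: "prime p"
  let ?g = "gcd n (2 * k + 1)"
  have n: "n > 0"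
    using assms by (auto intro: Nat.gr0I)
  show "multiplicity p ?g \<le> multiplicity p (denominator_bound n k)"
  proof (cases "p dvd n")
    case True
    define q where "q = (p - 1) div 2"
    define v where "v = multiplicity p ?g"
    have "odd p"
      using True assms by (metis dvd_trans)
    then have p_eq: "p = 2 * q + 1"
      by (simp add: q_def)
    then have "q > 0"
      using p by (auto intro: Nat.gr0I)
    have bernoulli: "1 + 2 * q * w \<le> p ^ w" for w
    proof (induction w)
      case (Suc w)
      have "1 + 2 * q * Suc w \<le> (1 + 2 * q) * (1 + 2 * q * w)"
        by (simp add: algebra_simps)
      also have "\<dots> \<le> p * p ^ w"
        using Suc p_eq by (intro mult_mono) auto
      finally show ?case
        by simp
    qed simp
    have "p ^ v dvd 2 * k + 1"
      using multiplicity_dvd[of p ?g] unfolding v_def by (metis dvd_trans gcd_dvd2)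
    then have "p ^ v \<le> 2 * k + 1"
      by (rule dvd_imp_le) simp
    with bernoulli[of v] have "q * v \<le> k"
      by linarith
    then have "v \<le> k div q"
      using \<open>q > 0\<close> by (simp add: less_eq_div_iff_mult_less_eq mult.commute)
    moreover have "multiplicity p (denominator_bound n k) = k div q"
      unfolding denominator_bound_def q_def
      using p True n by (subst multiplicity_prod_prime_powers) (auto simp: prime_factors_dvd)
    ultimately show ?thesis
      by (simp add: v_def)
  next
    case False
    then have "\<not> p dvd ?g"
      by (metis dvd_trans gcd_dvd1)
    then show ?thesis
      by (simp add: not_dvd_imp_multiplicity_0)
  qed
qed simp

lemma nat_multiple_Ints: "x dvd y \<Longrightarrow> of_nat x * (c::rat) \<in> \<int> \<Longrightarrow> of_nat y * c \<in> \<int>"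
proof -
  assume "x dvd y" and x: "of_nat x * c \<in> \<int>"
  then obtain w where y: "y = x * w"
    by (elim dvdE)
  have "of_nat y * c = of_nat w * (of_nat x * c)"
    by (simp add: y)
  then show ?thesis
    using x by (simp only: Ints_mult Ints_of_nat)
qed

text \<open>
  Both factors \<open>2 * m + 1\<close> and \<open>2 * k + 1\<close> clear the denominator of \<open>h m k\<close>, hence so does their greatest
  common divisor.
\<close>

lemma denominator_bound_mult_h: "of_nat (denominator_bound (2 * m + 1) k) * h m k \<in> \<int>"
proof -
  let ?n = "2 * m + 1" and ?l = "2 * k + 1"
  have "of_nat ?n * h m k \<in> \<int>"
    by (metis dirichlet_coeff_eq_h Ints_of_nat)
  moreover have "(of_nat ?l :: rat) \<noteq> 0"
    by (metis of_nat_eq_0_iff Suc_eq_plus1 nat.distinct(1))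
  then have "of_nat ?l * h m k = of_nat ((m + k) choose (2 * k))"
    unfolding h_def by (simp only: times_divide_eq_right nonzero_mult_div_cancel_left not_False_eq_True)
  then have "of_nat ?l * h m k \<in> \<int>"
    by (metis Ints_of_nat)
  moreover obtain u v where "u * int ?n + v * int ?l = gcd (int ?n) (int ?l)"
    using bezout_int by blast
  then have "of_int (int (gcd ?n ?l)) * h m k = of_int (u * int ?n + v * int ?l) * h m k"
    by (simp only: gcd_int_int_eq)
  then have "of_nat (gcd ?n ?l) * h m k = of_int u * (of_nat ?n * h m k) + of_int v * (of_nat ?l * h m k)"
    by (simp only: of_int_add of_int_mult of_int_of_nat_eq distrib_right mult.assoc)
  ultimately have "of_nat (gcd ?n ?l) * h m k \<in> \<int>"
    by (simp only: Ints_add Ints_mult Ints_of_int)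
  then show ?thesis
    by (rule nat_multiple_Ints[rotated]) (rule gcd_dvd_denominator_bound, simp)
qed

text \<open>
  In the recurrence at the index \<open>t + 1\<close> the terms with \<open>k \<le> t\<close> have positive index and the budget
  \<open>t\<close> is shared as \<open>k + (t - k)\<close> between \<open>h m k\<close> and \<open>fib_seq\<close>; for \<open>k > t\<close> the factor \<open>2 * m + 1\<close> of
  \<open>fib_seq\<close> at nonpositive indices already clears the denominator of \<open>h m k\<close>.
\<close>

lemma denominator_bound_mult_fib_seq:
  assumes "m \<ge> 1" "1 \<le> j" "j \<le> m"
  shows "of_nat (denominator_bound (2 * m + 1) t) * fib_seq m j (int t + 1) \<in> \<int>"
proof (induction t rule: less_induct)
  case (less t)
  let ?n = "2 * m + 1"
  let ?d = "denominator_bound ?n"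
  have summand: "of_nat (?d t) * (h m k * fib_seq m j (int t + 1 - int k)) \<in> \<int>" if "k \<ge> 1" for k
  proof (cases "k \<le> t")
    case True
    have "of_nat (?d (t - k)) * fib_seq m j (int (t - k) + 1) \<in> \<int>"
      using True that by (intro less.IH) simp
    moreover have "int (t - k) + 1 = int t + 1 - int k"
      using True by simp
    ultimately have "(of_nat (?d k) * h m k) * (of_nat (?d (t - k)) * fib_seq m j (int t + 1 - int k)) \<in> \<int>"
      using denominator_bound_mult_h Ints_mult by metis
    then have "of_nat (?d k * ?d (t - k)) * (h m k * fib_seq m j (int t + 1 - int k)) \<in> \<int>"
      by (simp add: algebra_simps)
    moreover have "?d k * ?d (t - k) dvd ?d t"
      using denominator_bound_mult_dvd[of ?n k "t - k"] True by simp
    ultimately show ?thesis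
      using nat_multiple_Ints by blast
  next
    case False
    define s where "s = k - 1 - t"
    have "int t + 1 - int k = - int s"
      using False by (simp add: s_def)
    then have "h m k * fib_seq m j (int t + 1 - int k)
        = of_nat (dirichlet_coeff m k) * of_int (fleck (2 * s + 1) (int s + int j) ?n)"
      using fib_seq_nonpos[OF assms, of s] by (simp only: dirichlet_coeff_eq_h mult_ac)
    then show ?thesis
      by simp
  qed
  have "of_nat (?d t) * fib_seq m j (int t + 1)
      = - (\<Sum>k=1..m. of_nat (?d t) * (h m k * fib_seq m j (int t + 1 - int k)))"
    by (subst fib_seq_recurrence[OF assms]) (simp add: sum_distrib_left)
  also have "\<dots> \<in> \<int>"
    using summand by (intro Ints_minus Ints_sum) auto
  finally show ?case .
qed

section \<open>Integrality and identification with Fleck quotients\<close>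

lemma fib_seq_eq_fleck:
  assumes "m \<ge> 1" "1 \<le> j" "j \<le> m" "r \<le> 0"
  shows "fib_seq m j r
    = of_nat (2 * m + 1) * of_int (fleck (nat (- 2 * r + 1)) (- r + int j) (2 * m + 1))"
proof -
  define s where "s = nat (- r)"
  have "r = - int s" "nat (- 2 * r + 1) = 2 * s + 1" "- r + int j = int s + int j"
    using assms(4) by (auto simp: s_def)
  then show ?thesis
    using fib_seq_nonpos[OF assms(1-3), of s] by (simp only:)
qed

theorem theorem6:
  fixes m n j :: nat
  assumes "m \<ge> 1" and "n = 2 * m + 1" and "1 \<le> j" and "j \<le> m"
  shows "(\<forall>r::int. r > 0 \<longrightarrow> N_seq m j r \<in> \<int>)
    \<and> (\<forall>r::int. r \<le> 0 \<longrightarrow> card (prime_factors n) \<ge> 2 \<longrightarrow>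
         N_seq m j r = of_nat n * of_int (fleck (nat (- 2 * r + 1)) (- r + int j) n))
    \<and> (\<forall>(r::int) (p::nat) (\<alpha>::nat). r \<le> 0 \<longrightarrow> prime p \<longrightarrow> n = p ^ \<alpha> \<longrightarrow>
         N_seq m j r =
           of_nat p powi (- ((- 2 * r + 1 - int p ^ (\<alpha> - 1)) div (int p ^ \<alpha> - int p ^ (\<alpha> - 1))))
             * of_int (fleck (nat (- 2 * r + 1)) (- r + int j) n))"
proof (intro conjI allI impI)
  fix r :: int assume "r > 0"
  define t where "t = nat (r - 1)"
  have r: "r = int t + 1"
    using \<open>r > 0\<close> by (simp add: t_def)
  have "(\<Prod>p\<in>prime_factors (2 * m + 1). of_nat p powi ((r - 1) div int ((p - 1) div 2)))
      = (of_nat (denominator_bound (2 * m + 1) t) :: rat)"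
    unfolding denominator_bound_def of_nat_prod of_nat_power r
    by (simp add: zdiv_int[symmetric] del: of_nat_div)
  then have "N_seq m j r = of_nat (denominator_bound (2 * m + 1) t) * fib_seq m j (int t + 1)"
    using \<open>r > 0\<close> by (simp add: N_seq_def r)
  then show "N_seq m j r \<in> \<int>"
    using denominator_bound_mult_fib_seq[OF assms(1,3,4)] by simp
next
  fix r :: int assume r: "r \<le> 0" and card: "card (prime_factors n) \<ge> 2"
  show "N_seq m j r = of_nat n * of_int (fleck (nat (- 2 * r + 1)) (- r + int j) n)"
    using r card fib_seq_eq_fleck[OF assms(1,3,4) r] by (simp add: N_seq_def assms(2))
next
  fix r :: int and p \<alpha> :: nat
  assume r: "r \<le> 0" and p: "prime p" and n: "n = p ^ \<alpha>"
  let ?e = "(- 2 * r + 1 - int p ^ (\<alpha> - 1)) div (int p ^ \<alpha> - int p ^ (\<alpha> - 1))"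
  have "\<alpha> > 0"
    using n assms(1,2) by (cases \<alpha>) auto
  then have pf: "prime_factors (2 * m + 1) = {p}"
    using p unfolding assms(2)[symmetric] n
    by (auto simp: prime_factors_dvd dest: prime_dvd_power primes_dvd_imp_eq)
  have mult: "multiplicity p (2 * m + 1) = \<alpha>"
    using p n assms(2) by (metis multiplicity_same_power not_prime_0 not_prime_unit)
  have "N_seq m j r = of_nat p powi (- int \<alpha> - ?e) * fib_seq m j r"
    using r unfolding N_seq_def Let_def pf by (simp add: mult[simplified])
  also have "of_nat p powi (- int \<alpha> - ?e) = of_nat p powi (- ?e) / (of_nat n :: rat)"
    using p by (simp add: n power_int_diff power_int_minus divide_simps)
  finally have N: "N_seq m j r = of_nat p powi (- ?e) / of_nat n * fib_seq m j r" .
  have cancel: "x / y * (y * z) = x * z" if "y \<noteq> 0" for x y z :: rat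
    using that by simp
  have "(of_nat n :: rat) \<noteq> 0"
    using p n by simp
  then show "N_seq m j r = of_nat p powi (- ?e) * of_int (fleck (nat (- 2 * r + 1)) (- r + int j) n)"
    unfolding N fib_seq_eq_fleck[OF assms(1,3,4) r, folded assms(2)] by (rule cancel)
qed

end
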